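(* Let $f$ be the function defined in the context. For every integer $k \geq 0$ we have $f(k+1) \leq f(k)+f(\lfloor k/4 \rfloor)$. Consequently, $f(k) \leq 2^{(\log_2 (4k))^2/4}$ for every integer $k \geq 1$.
   Context: All graphs are finite and simple. For a positive integer $k$, $f(k)$ denotes the maximum possible chromatic number of a graph whose edge set can be partitioned into at most $k$ complete bipartite graphs (i.e., $E(G)$ is a disjoint union of the edge sets of at most $k$ complete bipartite subgraphs of $G$). By convention $f(0)=1$. *)

theory Defs
  imports Complex_Main "HOL-Library.Disjoint_Sets" "Graph_Theory.Graph_Theory"
begin

text \<open>
  Finite simple graphs are the symmetric loop-free pair digraphs of the locale \<^locale>\<open>pair_graph\<close>:
  an edge between \<open>u\<close> and \<open>v\<close> is the pair of arcs \<open>(u,v)\<close>, \<open>(v,u)\<close>.  Every graph carries both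
  arcs of each of its edges, so partitioning the edge set of \<open>G\<close> into edge sets of subgraphs is the
  same as partitioning \<open>parcs G\<close> into arc sets of subgraphs.
\<close>

definition proper_colouring :: "'a pair_pre_digraph \<Rightarrow> ('a \<Rightarrow> nat) \<Rightarrow> bool" where
  "proper_colouring G c \<longleftrightarrow> (\<forall>(u, v) \<in> parcs G. c u \<noteq> c v)"

definition colourable :: "'a pair_pre_digraph \<Rightarrow> nat \<Rightarrow> bool" where
  "colourable G n \<longleftrightarrow> (\<exists>c. c ` pverts G \<subseteq> {..<n} \<and> proper_colouring G c)"

definition chromatic_number :: "'a pair_pre_digraph \<Rightarrow> nat" where
  "chromatic_number G = (LEAST n. colourable G n)"

definition complete_bipartite :: "'a pair_pre_digraph \<Rightarrow> bool" where
  "complete_bipartite H \<longleftrightarrow> (\<exists>m n. K\<^bsub>m,n\<^esub> (with_proj H))"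

definition biclique_partition :: "'a pair_pre_digraph \<Rightarrow> ('a \<times> 'a) set set \<Rightarrow> bool" where
  "biclique_partition G P \<longleftrightarrow> partition_on (parcs G) P \<and>
     (\<forall>F \<in> P. \<exists>H. subgraph (with_proj H) (with_proj G) \<and> complete_bipartite H \<and> parcs H = F)"

definition partitionable_into_bicliques :: "'a pair_pre_digraph \<Rightarrow> nat \<Rightarrow> bool" where
  "partitionable_into_bicliques G k \<longleftrightarrow> (\<exists>P. biclique_partition G P \<and> card P \<le> k)"

text \<open>
  Vertices may be taken to be natural numbers since graphs are finite; the lemma
  \<open>chromatic_number_le_max_chromatic\<close> below covers every vertex type.  The maximum is over a finite
  nonempty set by \<open>finite_chromatic_numbers\<close> and \<open>one_in_chromatic_numbers\<close>, and the convention
  \<open>f(0) = 1\<close> is the lemma \<open>max_chromatic_0\<close>.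
\<close>

definition chromatic_numbers :: "nat \<Rightarrow> nat set" where
  "chromatic_numbers k = {chromatic_number G | G :: nat pair_pre_digraph.
     pair_graph G \<and> partitionable_into_bicliques G k}"

definition max_chromatic :: "nat \<Rightarrow> nat" where
  "max_chromatic k = Max (chromatic_numbers k)"


lemma chromatic_number_le:
  assumes "colourable G n" shows "chromatic_number G \<le> n"
  using assms unfolding chromatic_number_def by (rule Least_le)

lemma colourable_card:
  assumes "finite C" "c ` pverts G \<subseteq> C" "\<And>u v. (u, v) \<in> parcs G \<Longrightarrow> c u \<noteq> c v"
    and G: "pair_graph G"
  shows "colourable G (card C)"
proof -
  interpret pair_graph G by (rule G)
  obtain h where h: "bij_betw h C {0..<card C}"
    using ex_bij_betw_finite_nat assms(1) by blast
  have mem: "c u \<in> C \<and> c v \<in> C" if "(u, v) \<in> parcs G" for u v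
    using that assms(2) in_arcsD1 in_arcsD2 by blast
  have "(h \<circ> c) ` pverts G \<subseteq> {..<card C}"
    using h assms(2) by (fastforce simp: bij_betw_def)
  moreover have "proper_colouring G (h \<circ> c)"
    unfolding proper_colouring_def
    using h mem assms(3) by (auto simp: bij_betw_def dest!: inj_onD)
  ultimately show ?thesis unfolding colourable_def by blast
qed

lemma colourable_chromatic_number:
  assumes G: "pair_graph G"
  shows "colourable G (chromatic_number G)"
proof -
  interpret pair_graph G by (rule G)
  have "colourable G (card (pverts G))"
    using colourable_card[of "pverts G" id G] G pair_finite_verts no_loops' by auto
  then show ?thesis unfolding chromatic_number_def by (rule LeastI)
qed

lemma complete_bipartite_iff:
  "complete_bipartite H \<longleftrightarrow> finite (pverts H) \<and>
     (\<exists>U V. pverts H = U \<union> V \<and> U \<inter> V = {} \<and> parcs H = U \<times> V \<union> V \<times> U)"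
  unfolding complete_bipartite_def complete_bipartite_digraph_pair_def by blast

lemma finite_biclique_partition:
  assumes "pair_graph G" "biclique_partition G P" shows "finite P"
proof -
  interpret pair_graph G by (rule assms)
  show ?thesis
    using assms(2) finite_elements[OF pair_finite_arcs] unfolding biclique_partition_def by blast
qed

lemma chromatic_number_le_power:
  assumes G: "pair_graph G" and "partitionable_into_bicliques G k"
  shows "chromatic_number G \<le> 2 ^ k"
proof -
  obtain P where P: "biclique_partition G P" and card: "card P \<le> k"
    using assms(2) unfolding partitionable_into_bicliques_def by blast
  have finP: "finite P" using finite_biclique_partition G P by blast
  have union: "\<Union>P = parcs G"
    using P unfolding biclique_partition_def partition_on_def by simp
  have "\<forall>F \<in> P. \<exists>U. \<forall>(u, v) \<in> F. (u \<in> U) \<noteq> (v \<in> U)"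
  proof
    fix F assume "F \<in> P"
    then obtain H where "complete_bipartite H" "parcs H = F"
      using P unfolding biclique_partition_def by blast
    then obtain U V where "U \<inter> V = {}" "F = U \<times> V \<union> V \<times> U"
      unfolding complete_bipartite_iff by blast
    then show "\<exists>U. \<forall>(u, v) \<in> F. (u \<in> U) \<noteq> (v \<in> U)" by (intro exI[of _ U]) auto
  qed
  then obtain U where U: "\<forall>F \<in> P. \<forall>(u, v) \<in> F. (u \<in> U F) \<noteq> (v \<in> U F)"
    by (rule bchoice[THEN exE])
  let ?c = "\<lambda>v. {F \<in> P. v \<in> U F}"
  have "?c u \<noteq> ?c v" if uv: "(u, v) \<in> parcs G" for u v
  proof -
    obtain F where F: "F \<in> P" "(u, v) \<in> F"
      using uv union by blast
    then have "(u \<in> U F) \<noteq> (v \<in> U F)" using U by blast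
    then show ?thesis using F(1) by blast
  qed
  then have "colourable G (card (Pow P))"
    using finP by (intro colourable_card[of "Pow P" ?c] G) auto
  then have "chromatic_number G \<le> 2 ^ card P"
    using chromatic_number_le finP by (simp add: card_Pow)
  also have "\<dots> \<le> 2 ^ k" using card by simp
  finally show ?thesis .
qed

lemma finite_chromatic_numbers: "finite (chromatic_numbers k)"
  by (rule finite_subset[of _ "{..2 ^ k}"])
    (auto simp: chromatic_numbers_def chromatic_number_le_power)

lemma one_in_chromatic_numbers: "1 \<in> chromatic_numbers k"
proof -
  let ?G = "\<lparr>pverts = {0}, parcs = {}\<rparr> :: nat pair_pre_digraph"
  have G: "pair_graph ?G"
    by unfold_locales (auto simp: arcs_ends_def symmetric_def)
  have "colourable ?G n \<longleftrightarrow> 1 \<le> n" for n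
    by (auto simp: colourable_def proper_colouring_def intro: exI[of _ "\<lambda>_. 0"])
  then have "chromatic_number ?G = 1"
    unfolding chromatic_number_def by (intro Least_equality) auto
  moreover have "partitionable_into_bicliques ?G k"
    unfolding partitionable_into_bicliques_def biclique_partition_def
    by (intro exI[of _ "{}"]) (auto simp: partition_on_empty)
  ultimately show ?thesis
    using G unfolding chromatic_numbers_def by (metis (mono_tags, lifting) mem_Collect_eq)
qed

lemma max_chromatic_0: "max_chromatic 0 = 1"
proof -
  have "max_chromatic 0 \<in> chromatic_numbers 0"
    unfolding max_chromatic_def using finite_chromatic_numbers one_in_chromatic_numbers
    by (intro Max_in) auto
  then have "max_chromatic 0 \<le> 1"
    unfolding chromatic_numbers_def using chromatic_number_le_power[where k = 0] by auto
  moreover have "1 \<le> max_chromatic 0"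
    unfolding max_chromatic_def using finite_chromatic_numbers one_in_chromatic_numbers
    by (intro Max_ge) auto
  ultimately show ?thesis by simp
qed

lemma chromatic_number_le_max_chromatic:
  fixes G :: "'a pair_pre_digraph"
  assumes G: "pair_graph G" and "partitionable_into_bicliques G k"
  shows "chromatic_number G \<le> max_chromatic k"
proof -
  interpret pair_graph G by (rule G)
  obtain P where P: "biclique_partition G P" and card: "card P \<le> k"
    using assms(2) unfolding partitionable_into_bicliques_def by blast
  obtain g :: "'a \<Rightarrow> nat" where g: "inj_on g (pverts G)"
    using finite_imp_inj_to_nat_seg pair_finite_verts by blast
  let ?h = "map_prod g g"
  let ?G = "\<lparr>pverts = g ` pverts G, parcs = ?h ` parcs G\<rparr>"
  have arcs: "parcs G \<subseteq> pverts G \<times> pverts G"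
    using in_arcsD1 in_arcsD2 by auto
  have inj_h: "inj_on ?h (pverts G \<times> pverts G)"
    by (rule map_prod_inj_on[OF g g])
  have sym: "(v, u) \<in> parcs G" if "(u, v) \<in> parcs G" for u v
    using that arcs_symmetric by blast
  have G': "pair_graph ?G"
  proof
    show "symmetric (with_proj ?G)"
      using sym by (fastforce simp: symmetric_def sym_def arcs_ends_conv)
  next
    fix e assume "e \<in> parcs ?G"
    then obtain u v where "(u, v) \<in> parcs G" "e = (g u, g v)" by auto
    then show "fst e \<noteq> snd e"
      using arcs no_loops'[of u v] inj_onD[OF g, of u v] by auto
  qed (use arcs pair_finite_verts pair_finite_arcs in auto)
  have Psub: "\<And>F. F \<in> P \<Longrightarrow> F \<subseteq> pverts G \<times> pverts G"
    using P arcs unfolding biclique_partition_def partition_on_def by blast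
  have "partition_on (parcs ?G) ((`) ?h ` P)"
  proof (rule partition_onI)
    have "\<Union> ((`) ?h ` P) = ?h ` \<Union> P" by (rule image_Union[symmetric])
    then show "\<Union> ((`) ?h ` P) = parcs ?G"
      using P unfolding biclique_partition_def partition_on_def by simp
    show "{} \<notin> (`) ?h ` P"
      using P unfolding biclique_partition_def partition_on_def by auto
    fix p q assume "p \<in> (`) ?h ` P" "q \<in> (`) ?h ` P" "p \<noteq> q"
    then obtain A B where AB: "A \<in> P" "B \<in> P" "p = ?h ` A" "q = ?h ` B" "A \<noteq> B" by blast
    then have "A \<inter> B = {}"
      using P unfolding biclique_partition_def partition_on_def disjoint_def by blast
    then show "disjnt p q"
      using inj_on_image_Int[OF inj_h Psub[OF AB(1)] Psub[OF AB(2)]] AB by (simp add: disjnt_def)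
  qed
  moreover have "\<exists>H. subgraph (with_proj H) (with_proj ?G) \<and> complete_bipartite H \<and> parcs H = F'"
    if F': "F' \<in> (`) ?h ` P" for F'
  proof -
    obtain F where F: "F \<in> P" "F' = ?h ` F" using F' by blast
    obtain H where H: "subgraph (with_proj H) (with_proj G)" "complete_bipartite H" "parcs H = F"
      using P F unfolding biclique_partition_def by blast
    obtain U V where UV: "pverts H = U \<union> V" "U \<inter> V = {}" "F = U \<times> V \<union> V \<times> U"
      "finite (pverts H)"
      using H unfolding complete_bipartite_iff by blast
    have sub: "pverts H \<subseteq> pverts G" "parcs H \<subseteq> parcs G" using H(1) by (auto simp: subgraph_def)
    let ?H = "\<lparr>pverts = g ` pverts H, parcs = ?h ` F\<rparr>"
    have "g ` U \<inter> g ` V = {}"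
      using inj_on_image_Int[OF g, of U V] UV sub by auto
    moreover have "?h ` F = g ` U \<times> g ` V \<union> g ` V \<times> g ` U"
      unfolding UV(3) image_Un map_prod_surj_on[OF refl refl] ..
    ultimately have cb: "complete_bipartite ?H"
      unfolding complete_bipartite_iff using UV by (auto simp: image_Un)
    then have "pair_graph ?H"
      unfolding complete_bipartite_def using pair_graphI_complete_bipartite by blast
    then have "subgraph (with_proj ?H) (with_proj ?G)"
      using G' sub H(3) unfolding subgraph_def
      by (auto simp: compatible_def wf_digraph_wp_iff pair_graph_def pair_digraph_def
          pair_fin_digraph_def)
    then show ?thesis using cb F(2) by force
  qed
  ultimately have "biclique_partition ?G ((`) ?h ` P)"
    unfolding biclique_partition_def by blast
  moreover have "card ((`) ?h ` P) \<le> k"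
    using card_image_le[OF finite_biclique_partition[OF G P]] card le_trans by blast
  ultimately have "partitionable_into_bicliques ?G k"
    unfolding partitionable_into_bicliques_def by blast
  then have "chromatic_number ?G \<in> chromatic_numbers k"
    using G' unfolding chromatic_numbers_def by blast
  then have le: "chromatic_number ?G \<le> max_chromatic k"
    unfolding max_chromatic_def using finite_chromatic_numbers by simp
  obtain c where c: "c ` pverts ?G \<subseteq> {..<chromatic_number ?G}" "proper_colouring ?G c"
    using colourable_chromatic_number[OF G'] unfolding colourable_def by blast
  have "colourable G (chromatic_number ?G)"
    unfolding colourable_def
    by (rule exI[of _ "c \<circ> g"]) (use c in \<open>auto simp: proper_colouring_def\<close>)
  then show ?thesis using chromatic_number_le le le_trans by blast
qed

end

theory Submission
  imports Defs
begin

text \<open>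
  Let the edges of \<open>G\<close> be partitioned into \<open>n\<close> bicliques, and say that a biclique \<open>F'\<close> crosses a
  side \<open>S\<close> of another biclique \<open>F\<close> if \<open>F'\<close> has an edge inside \<open>S\<close>.  Then, by edge-disjointness,
  \<open>F'\<close> avoids the opposite side of \<open>F\<close>, so an unordered pair of bicliques accounts for at most one
  crossing.  There are \<open>2 n\<close> sides and at most \<open>n (n - 1) / 2\<close> crossings, so some side \<open>S\<close> is
  crossed by at most \<open>(n - 1) / 4\<close> bicliques.  Colour \<open>G[S]\<close> and \<open>G - S\<close> with disjoint sets of
  colours; the biclique with side \<open>S\<close> has no edge in either.

  The bound follows by induction, as \<open>g x = 2 powr ((log 2 (4 * x))\<^sup>2 / 4)\<close> satisfies
  \<open>g x = 2 * x * g (x / 4)\<close> and \<open>g (x + 1) \<ge> (1 + 1 / x) * g x\<close> for \<open>x \<ge> 1\<close>.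
\<close>

section \<open>Induced subgraphs\<close>

text \<open>\<open>W\<close> may contain non-vertices, so the complement \<open>- W\<close> can be
  used to delete \<open>W\<close>.\<close>

definition induced :: "'a pair_pre_digraph \<Rightarrow> 'a set \<Rightarrow> 'a pair_pre_digraph" where
  "induced G W = \<lparr>pverts = pverts G \<inter> W, parcs = parcs G \<inter> W \<times> W\<rparr>"

lemma induced_simps [simp]:
  "pverts (induced G W) = pverts G \<inter> W" "parcs (induced G W) = parcs G \<inter> W \<times> W"
  by (simp_all add: induced_def)

lemma pair_graph_induced:
  assumes "pair_graph G" shows "pair_graph (induced G W)"
proof -
  interpret pair_graph G by (rule assms)
  have sym: "(v, u) \<in> parcs G" if "(u, v) \<in> parcs G" for u v
    using that arcs_symmetric by blast
  show ?thesis
  proof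
    show "symmetric (with_proj (induced G W))"
      using sym by (fastforce simp: symmetric_def sym_def arcs_ends_conv)
  next
    fix e assume "e \<in> parcs (induced G W)"
    then show "fst e \<noteq> snd e" using no_loops'[of "fst e" "snd e"] by auto
  qed (use in_arcsD1 in_arcsD2 pair_finite_verts pair_finite_arcs in auto)
qed

text \<open>Intersect both sides with \<open>W\<close>; a side may become empty, which
  \<open>complete_bipartite\<close> permits.\<close>

lemma complete_bipartite_induced:
  assumes "complete_bipartite H" shows "complete_bipartite (induced H W)"
proof -
  obtain U V where UV: "finite (pverts H)" "pverts H = U \<union> V" "U \<inter> V = {}"
    "parcs H = U \<times> V \<union> V \<times> U"
    using assms unfolding complete_bipartite_iff by blast
  show ?thesis
    unfolding complete_bipartite_iff using UV
    by (intro conjI exI[of _ "U \<inter> W"] exI[of _ "V \<inter> W"]) auto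
qed

text \<open>Cut every biclique down to \<open>W\<close>. One without an edge inside \<open>W\<close>
  would leave an empty block, which \<open>partition_on\<close> forbids, so only the survivors
  \<open>Q\<close> are kept and counted.\<close>

lemma partitionable_induced:
  assumes G: "pair_graph G" and P: "biclique_partition G P"
    and card: "card {F \<in> P. F \<inter> W \<times> W \<noteq> {}} \<le> k"
  shows "partitionable_into_bicliques (induced G W) k"
proof -
  define Q where "Q = {F \<in> P. F \<inter> W \<times> W \<noteq> {}}"
  let ?r = "\<lambda>F. F \<inter> W \<times> W"
  have part: "partition_on (parcs G) P" using P unfolding biclique_partition_def by blast
  have "partition_on (parcs (induced G W)) (?r ` Q)"
  proof (rule partition_onI)
    show "\<Union> (?r ` Q) = parcs (induced G W)"
      using partition_onD1[OF part] by (auto simp: Q_def)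
    show "{} \<notin> ?r ` Q" by (auto simp: Q_def)
    fix p q assume "p \<in> ?r ` Q" "q \<in> ?r ` Q" "p \<noteq> q"
    then show "disjnt p q"
      using partition_onD2[OF part] by (fastforce simp: Q_def disjnt_def disjoint_def)
  qed
  moreover have "\<exists>H. subgraph (with_proj H) (with_proj (induced G W)) \<and>
      complete_bipartite H \<and> parcs H = F'" if F': "F' \<in> ?r ` Q" for F'
  proof -
    obtain F where F: "F \<in> P" "F' = ?r F" using F' by (auto simp: Q_def)
    obtain H where H: "subgraph (with_proj H) (with_proj G)" "complete_bipartite H" "parcs H = F"
      using P F unfolding biclique_partition_def by blast
    have cb: "complete_bipartite (induced H W)"
      by (rule complete_bipartite_induced[OF H(2)])
    then have "pair_graph (induced H W)"
      unfolding complete_bipartite_def using pair_graphI_complete_bipartite by blast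
    then have "subgraph (with_proj (induced H W)) (with_proj (induced G W))"
      using pair_graph_induced[OF G, of W] H(1) unfolding subgraph_def
      by (auto simp: compatible_def wf_digraph_wp_iff pair_graph_def pair_digraph_def
          pair_fin_digraph_def)
    then show ?thesis using cb F(2) H(3) by force
  qed
  moreover have "card (?r ` Q) \<le> k"
    using card_image_le[of Q ?r] finite_biclique_partition[OF G P] card
    by (simp add: Q_def)
  ultimately show ?thesis
    unfolding partitionable_into_bicliques_def biclique_partition_def by blast
qed

lemma chromatic_number_le_induced:
  assumes G: "pair_graph G"
  shows "chromatic_number G \<le> chromatic_number (induced G (- W)) + chromatic_number (induced G W)"
proof -
  let ?a = "chromatic_number (induced G (- W))" and ?b = "chromatic_number (induced G W)"
  obtain c where c: "c ` pverts (induced G (- W)) \<subseteq> {..<?a}" "proper_colouring (induced G (- W)) c"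
    using colourable_chromatic_number[OF pair_graph_induced[OF G]] unfolding colourable_def by blast
  obtain d where d: "d ` pverts (induced G W) \<subseteq> {..<?b}" "proper_colouring (induced G W) d"
    using colourable_chromatic_number[OF pair_graph_induced[OF G]] unfolding colourable_def by blast
  interpret pair_graph G by (rule G)
  \<comment> \<open>The shift by \<open>?a\<close> makes the palettes disjoint, so edges between
    \<open>W\<close> and its complement cause no clash.\<close>
  define e where "e = (\<lambda>v. if v \<in> W then ?a + d v else c v)"
  have less: "c v < ?a" if "v \<in> pverts G" "v \<notin> W" for v
    using c(1) that by auto
  have "e u \<noteq> e v" if uv: "(u, v) \<in> parcs G" for u v
  proof -
    have "u \<in> pverts G" "v \<in> pverts G" using uv in_arcsD1 in_arcsD2 by blast+
    with less[of u] less[of v] show ?thesis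
      using uv c(2) d(2) by (auto simp: e_def proper_colouring_def)
  qed
  then have "proper_colouring G e" unfolding proper_colouring_def by blast
  moreover have "e ` pverts G \<subseteq> {..<?a + ?b}"
    using d(1) less by (auto simp: e_def trans_less_add1)
  ultimately have "colourable G (?a + ?b)" unfolding colourable_def by blast
  then show ?thesis by (rule chromatic_number_le)
qed

section \<open>A rarely crossed side\<close>

text \<open>The sides of a biclique \<open>F\<close> are \<open>S F True\<close> and \<open>S F False\<close>.\<close>

lemma card_crossings_le:
  fixes S :: "'i \<Rightarrow> bool \<Rightarrow> 'a set" and P :: "'i set"
  defines "E \<equiv> \<lambda>(F, b). {F' \<in> P. \<forall>c. S F' c \<inter> S F b \<noteq> {}}"
  assumes fin: "finite P"
    and disj: "\<And>F. F \<in> P \<Longrightarrow> S F True \<inter> S F False = {}"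
    and edge_disj: "\<And>F F' b c. F \<in> P \<Longrightarrow> F' \<in> P \<Longrightarrow> F \<noteq> F' \<Longrightarrow>
      S F b \<inter> S F' c = {} \<or> S F (\<not> b) \<inter> S F' (\<not> c) = {}"
  shows "(\<Sum>s \<in> P \<times> UNIV. card (E s)) \<le> card P choose 2"
proof -
  let ?X = "Sigma (P \<times> UNIV) E"
  let ?pair = "\<lambda>((F, b :: bool), F'). {F, F'}"
  have E_sub: "F' \<in> P" and meet: "S F' c \<inter> S F b \<noteq> {}" if "F' \<in> E (F, b)" for F F' b c
    using that by (simp_all add: E_def)
  have neq: "F \<noteq> F'" if "F \<in> P" "F' \<in> E (F, b)" for F F' b
    using meet[OF that(2), of "\<not> b"] disj[OF that(1)] by (cases b) (auto simp: Int_commute)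
  \<comment> \<open>The side of \<open>F'\<close> opposite to \<open>S F' c\<close> meets
    \<open>S F b\<close>, so \<open>S F' c\<close> must miss the other side of
    \<open>F\<close>.\<close>
  have avoid: "S F' c \<inter> S F (\<not> b) = {}" if "F \<in> P" "F' \<in> E (F, b)" for F F' b c
    using edge_disj[OF that(1) E_sub[OF that(2)] neq[OF that], of b "\<not> c"]
      meet[OF that(2), of "\<not> c"] by (simp add: Int_commute)
  have "inj_on ?pair ?X"
  proof (rule inj_onI)
    fix s t assume st: "s \<in> ?X" "t \<in> ?X" "?pair s = ?pair t"
    obtain F b F' where s: "s = ((F, b), F')" by (metis prod.exhaust)
    obtain G d G' where t: "t = ((G, d), G')" by (metis prod.exhaust)
    have F: "F \<in> P" "F' \<in> E (F, b)" and G: "G \<in> P" "G' \<in> E (G, d)"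
      and eq: "{F, F'} = {G, G'}"
      using st unfolding s t by simp_all
    \<comment> \<open>If \<open>F\<close> also crossed the side \<open>S F' d\<close>, then
      \<open>S F (\<not> b)\<close> would meet it, against \<open>avoid\<close>.\<close>
    have "\<not> (F = G' \<and> F' = G)"
      using meet[OF G(2), of "\<not> b"] avoid[OF F, of d] by (auto simp: Int_commute)
    then have FG: "F = G" "F' = G'" using eq by (auto simp: doubleton_eq_iff)
    \<comment> \<open>Likewise \<open>F'\<close> cannot cross both sides of
      \<open>F\<close>.\<close>
    then have "d \<noteq> (\<not> b)" using meet[OF G(2), of True] avoid[OF F, of True] by (metis (full_types))
    with FG show "s = t" by (auto simp: s t)
  qed
  moreover have "?pair ` ?X \<subseteq> {A. A \<subseteq> P \<and> card A = 2}"
  proof (rule image_subsetI)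
    fix s assume s: "s \<in> ?X"
    obtain F b F' where s_eq: "s = ((F, b), F')" by (metis prod.exhaust)
    then have F: "F \<in> P" "F' \<in> E (F, b)" using s by simp_all
    then have "card {F, F'} = 2" using neq by simp
    then show "?pair s \<in> {A. A \<subseteq> P \<and> card A = 2}" using F E_sub s_eq by simp
  qed
  moreover have "finite {A. A \<subseteq> P \<and> card A = 2}" using fin by simp
  ultimately have "card ?X \<le> card {A. A \<subseteq> P \<and> card A = 2}" by (rule card_inj_on_le)
  moreover have "card ?X = (\<Sum>s \<in> P \<times> UNIV. card (E s))"
    using fin finite_subset[OF _ fin] E_sub by (intro card_SigmaI) auto
  ultimately show ?thesis using n_subsets[OF fin] by simp
qed

lemma rarely_crossed_set:
  assumes G: "pair_graph G" and P: "biclique_partition G P" and "P \<noteq> {}"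
  obtains W F where "F \<in> P" "F \<inter> W \<times> W = {}" "F \<inter> (- W) \<times> (- W) = {}"
    "card {F \<in> P. F \<inter> W \<times> W \<noteq> {}} \<le> (card P - 1) div 4"
proof -
  have fin: "finite P" by (rule finite_biclique_partition[OF G P])
  \<comment> \<open>Indexing the sides by booleans treats them symmetrically; the union over
    \<open>b\<close> yields both arcs of each edge.\<close>
  have "\<forall>F \<in> P. \<exists>S. S True \<inter> S False = {} \<and> F = (\<Union>b. S b \<times> S (\<not> b))"
  proof
    fix F assume "F \<in> P"
    then obtain H where "complete_bipartite H" "parcs H = F"
      using P unfolding biclique_partition_def by blast
    then obtain U V where "U \<inter> V = {}" "F = U \<times> V \<union> V \<times> U"
      unfolding complete_bipartite_iff by blast
    then show "\<exists>S. S True \<inter> S False = {} \<and> F = (\<Union>b. S b \<times> S (\<not> b))"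
      by (intro exI[of _ "\<lambda>b. if b then U else V"]) (auto simp: UNIV_bool)
  qed
  from bchoice[OF this] obtain S where
    "\<forall>F \<in> P. S F True \<inter> S F False = {} \<and> F = (\<Union>b. S F b \<times> S F (\<not> b))" by blast
  then have disj: "\<And>F. F \<in> P \<Longrightarrow> S F True \<inter> S F False = {}"
    and S: "\<And>F. F \<in> P \<Longrightarrow> F = (\<Union>b. S F b \<times> S F (\<not> b))" by simp_all
  have S_iff: "(x, y) \<in> F \<longleftrightarrow> (\<exists>b. x \<in> S F b \<and> y \<in> S F (\<not> b))" if "F \<in> P" for F x y
    by (subst S[OF that]) auto
  have edge_disj: "S F b \<inter> S F' c = {} \<or> S F (\<not> b) \<inter> S F' (\<not> c) = {}"
    if "F \<in> P" "F' \<in> P" "F \<noteq> F'" for F F' b c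
  proof -
    have "F \<inter> F' = {}"
      using P that unfolding biclique_partition_def partition_on_def disjoint_def by blast
    then show ?thesis using S_iff that by blast
  qed
  define E where "E = (\<lambda>(F, b). {F' \<in> P. \<forall>c. S F' c \<inter> S F b \<noteq> {}})"
  define e where "e = Min ((\<lambda>s. card (E s)) ` (P \<times> UNIV))"
  have "e \<in> (\<lambda>s. card (E s)) ` (P \<times> UNIV)"
    unfolding e_def using fin \<open>P \<noteq> {}\<close> by (intro Min_in) auto
  then obtain F b where Fb: "F \<in> P" "card (E (F, b)) = e" by auto
  \<comment> \<open>Averaging: each of the \<open>2 * card P\<close> sides is crossed at least
    \<open>e\<close> times.\<close>
  have "card (P \<times> (UNIV :: bool set)) * e \<le> (\<Sum>s \<in> P \<times> UNIV. card (E s))"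
    using fin by (intro sum_bounded_below[where 'a = nat, simplified]) (auto simp: e_def)
  also have "\<dots> \<le> card P choose 2"
    unfolding E_def by (rule card_crossings_le[OF fin disj edge_disj])
  finally have "2 * card P * e \<le> card P * (card P - 1) div 2"
    by (simp add: choose_two card_cartesian_product)
  then have "card P * (4 * e) \<le> card P * (card P - 1)" by linarith
  then have "4 * e \<le> card P - 1" using fin \<open>P \<noteq> {}\<close> by (simp add: card_gt_0_iff)
  then have e: "e \<le> (card P - 1) div 4" by linarith
  \<comment> \<open>The ends of an edge of \<open>F'\<close> lie on different sides of
    \<open>F'\<close>, so an edge inside \<open>S F b\<close> makes both sides meet it.\<close>
  have "F' \<in> E (F, b)" if F': "F' \<in> P" "F' \<inter> S F b \<times> S F b \<noteq> {}" for F'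
  proof -
    obtain x y where xy: "(x, y) \<in> F'" "x \<in> S F b" "y \<in> S F b" using F'(2) by blast
    then obtain d where "x \<in> S F' d" "y \<in> S F' (\<not> d)" using S_iff[OF F'(1)] by blast
    with xy have "S F' c \<inter> S F b \<noteq> {}" for c by (cases "c = d") auto
    then show ?thesis using F'(1) by (simp add: E_def)
  qed
  then have "{F' \<in> P. F' \<inter> S F b \<times> S F b \<noteq> {}} \<subseteq> E (F, b)" by blast
  moreover have "E (F, b) \<subseteq> P" unfolding E_def by blast
  then have "finite (E (F, b))" using fin by (rule finite_subset)
  ultimately have "card {F' \<in> P. F' \<inter> S F b \<times> S F b \<noteq> {}} \<le> card (E (F, b))"
    by (intro card_mono)
  also have "\<dots> \<le> (card P - 1) div 4" unfolding Fb(2) by (rule e)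
  finally have "card {F' \<in> P. F' \<inter> S F b \<times> S F b \<noteq> {}} \<le> (card P - 1) div 4" .
  \<comment> \<open>Every edge of \<open>F\<close> has exactly one end in
    \<open>S F b\<close>.\<close>
  moreover have "F \<inter> S F b \<times> S F b = {}" "F \<inter> (- S F b) \<times> (- S F b) = {}"
  proof -
    have opp: "S F b \<inter> S F (\<not> b) = {}" using disj[OF Fb(1)] by (cases b) auto
    have "(x \<in> S F b) \<noteq> (y \<in> S F b)" if xy: "(x, y) \<in> F" for x y
    proof -
      obtain d where "x \<in> S F d" "y \<in> S F (\<not> d)" using xy S_iff[OF Fb(1)] by blast
      then show ?thesis using opp by (cases "d = b") auto
    qed
    then show "F \<inter> S F b \<times> S F b = {}" "F \<inter> (- S F b) \<times> (- S F b) = {}" by blast+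
  qed
  ultimately show ?thesis using that[OF Fb(1), of "S F b"] by blast
qed

section \<open>The recursion and its consequence\<close>

lemma max_chromatic_in: "max_chromatic k \<in> chromatic_numbers k"
  unfolding max_chromatic_def using finite_chromatic_numbers one_in_chromatic_numbers
  by (intro Max_in) auto

lemma chromatic_number_Suc_le:
  assumes G: "pair_graph G" and part: "partitionable_into_bicliques G (Suc k)"
  shows "chromatic_number G \<le> max_chromatic k + max_chromatic (k div 4)"
proof -
  obtain P where P: "biclique_partition G P" and card: "card P \<le> Suc k"
    using part unfolding partitionable_into_bicliques_def by blast
  show ?thesis
  proof (cases "P = {}")
    case True
    \<comment> \<open>Without bicliques there is no side to choose, but the first summand alone
      suffices.\<close>
    then have "partitionable_into_bicliques G k"
      using P unfolding partitionable_into_bicliques_def by (intro exI[of _ "{}"]) simp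
    then show ?thesis by (intro trans_le_add1 chromatic_number_le_max_chromatic[OF G])
  next
    case False
    obtain W F where F: "F \<in> P" "F \<inter> W \<times> W = {}" "F \<inter> (- W) \<times> (- W) = {}"
      and W: "card {F \<in> P. F \<inter> W \<times> W \<noteq> {}} \<le> (card P - 1) div 4"
      by (rule rarely_crossed_set[OF G P False])
    \<comment> \<open>\<open>F\<close> has no edge outside \<open>W\<close>, so at most
      \<open>card P - 1\<close> bicliques survive there.\<close>
    have "{F' \<in> P. F' \<inter> (- W) \<times> (- W) \<noteq> {}} \<subseteq> P - {F}" using F(3) by blast
    then have "card {F' \<in> P. F' \<inter> (- W) \<times> (- W) \<noteq> {}} \<le> card (P - {F})"
      by (rule card_mono[rotated]) (simp add: finite_biclique_partition[OF G P])
    also have "\<dots> \<le> k" using card F(1) by simp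
    finally have "partitionable_into_bicliques (induced G (- W)) k"
      by (rule partitionable_induced[OF G P])
    moreover have "(card P - 1) div 4 \<le> k div 4" using card by (intro div_le_mono) simp
    with W have "partitionable_into_bicliques (induced G W) (k div 4)"
      by (intro partitionable_induced[OF G P]) simp
    ultimately have "chromatic_number (induced G (- W)) \<le> max_chromatic k"
      "chromatic_number (induced G W) \<le> max_chromatic (k div 4)"
      by (simp_all add: chromatic_number_le_max_chromatic pair_graph_induced[OF G])
    then show ?thesis using chromatic_number_le_induced[OF G, of W] by linarith
  qed
qed

lemma max_chromatic_Suc_le: "max_chromatic (Suc k) \<le> max_chromatic k + max_chromatic (k div 4)"
proof -
  obtain G :: "nat pair_pre_digraph" where
    "max_chromatic (Suc k) = chromatic_number G" "pair_graph G" "partitionable_into_bicliques G (Suc k)"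
    using max_chromatic_in[of "Suc k"] unfolding chromatic_numbers_def by blast
  then show ?thesis using chromatic_number_Suc_le by metis
qed

text \<open>The induction step for the closed form. With \<open>r\<close> the second summand, the
  first is \<open>2 * x * r\<close>; growth by the factor \<open>(x + 1) / x\<close> adds
  \<open>2 * r\<close>, where \<open>r\<close> would do.\<close>

lemma powr_log_step:
  fixes x :: real
  assumes "1 \<le> x"
  shows "2 powr ((log 2 (4 * x))\<^sup>2 / 4) + 2 powr ((log 2 x)\<^sup>2 / 4) \<le>
    2 powr ((log 2 (4 * (x + 1)))\<^sup>2 / 4)"
proof -
  define a b where "a = log 2 x" and "b = log 2 (x + 1)"
  define r where "r = (2 :: real) powr (a\<^sup>2 / 4)"
  have log4: "log 2 (4 :: real) = 2" using log_pow_cancel[of 2 2] by simp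
  have a: "log 2 (4 * x) = a + 2" and b: "log 2 (4 * (x + 1)) = b + 2"
    unfolding a_def b_def using assms log4
    by (simp_all add: log_mult_pos del: distrib_left_numeral)
  have ab: "0 \<le> a" "a \<le> b" unfolding a_def b_def using assms by simp_all
  have pa: "2 powr a = x" and pb: "2 powr b = x + 1" unfolding a_def b_def using assms by simp_all
  have sq: "(a + 2)\<^sup>2 / 4 = a\<^sup>2 / 4 + a + 1" by (simp add: power2_eq_square field_simps)
  have low: "2 powr ((a + 2)\<^sup>2 / 4) = 2 * x * r"
    unfolding sq powr_add pa r_def by simp
  \<comment> \<open>Difference of squares; the last factor is at least 1 because \<open>a\<close>
    and \<open>b\<close> are nonnegative.\<close>
  have "(b + 2)\<^sup>2 / 4 = (a + 2)\<^sup>2 / 4 + (b - a) * ((a + b + 4) / 4)"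
    by (simp add: power2_eq_square field_simps)
  moreover have "(b - a) * 1 \<le> (b - a) * ((a + b + 4) / 4)"
    using ab by (intro mult_left_mono) auto
  ultimately have exponent: "(a + 2)\<^sup>2 / 4 + (b - a) \<le> (b + 2)\<^sup>2 / 4" by simp
  have "2 * x * r + 2 * r = 2 * x * r * ((x + 1) / x)"
    using assms by (simp add: field_simps)
  \<comment> \<open>Here \<open>(x + 1) / x\<close> is \<open>2 powr (b - a)\<close>.\<close>
  also have "\<dots> = 2 powr ((a + 2)\<^sup>2 / 4 + (b - a))"
    unfolding powr_add powr_diff pa pb low ..
  also have "\<dots> \<le> 2 powr ((b + 2)\<^sup>2 / 4)" using exponent by simp
  finally have "2 * x * r + 2 * r \<le> 2 powr ((b + 2)\<^sup>2 / 4)" .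
  moreover have "0 \<le> r" by (simp add: r_def)
  ultimately show ?thesis unfolding a b low a_def[symmetric] r_def[symmetric] by linarith
qed

lemma max_chromatic_le:
  assumes "1 \<le> k"
  shows "real (max_chromatic k) \<le> 2 powr ((log 2 (4 * real k))\<^sup>2 / 4)"
  using assms
proof (induction k rule: less_induct)
  case (less k)
  show ?case
  proof (cases "k = 1")
    case True
    \<comment> \<open>Both sides equal 2 here: the recursion gives \<open>1 + 1\<close>, and the
      exponent is \<open>2\<^sup>2 / 4 = 1\<close>.\<close>
    have "log 2 (4 :: real) = 2" using log_pow_cancel[of 2 2] by simp
    then show ?thesis using max_chromatic_Suc_le[of 0] True by (simp add: max_chromatic_0)
  next
    case False
    then obtain m where m: "k = Suc m" "1 \<le> m" using less.prems by (cases k) auto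
    have quarter: "real (max_chromatic (m div 4)) \<le> 2 powr ((log 2 (real m))\<^sup>2 / 4)"
    proof (cases "m div 4 = 0")
      case True
      \<comment> \<open>The induction hypothesis excludes 0, but \<open>max_chromatic 0 = 1\<close>
        and the exponent is nonnegative.\<close>
      then show ?thesis by (simp add: max_chromatic_0 ge_one_powr_ge_zero)
    next
      case False
      have "4 * real (m div 4) = real (4 * (m div 4))" by simp
      also have "\<dots> \<le> real m" by (intro of_nat_mono) simp
      finally have "log 2 (4 * real (m div 4)) \<le> log 2 (real m)" using False by simp
      \<comment> \<open>Squaring preserves the order since \<open>m div 4\<close> is at least 1,
        making the smaller logarithm nonnegative.\<close>
      then have "(log 2 (4 * real (m div 4)))\<^sup>2 \<le> (log 2 (real m))\<^sup>2"
        using False by (intro power_mono) auto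
      moreover have "real (max_chromatic (m div 4)) \<le>
          2 powr ((log 2 (4 * real (m div 4)))\<^sup>2 / 4)"
        using False m by (intro less.IH) auto
      ultimately show ?thesis by (smt (verit) divide_right_mono powr_mono)
    qed
    have "real (max_chromatic k) \<le> real (max_chromatic m) + real (max_chromatic (m div 4))"
      using max_chromatic_Suc_le[of m] m(1) by (metis of_nat_add of_nat_mono)
    also have "\<dots> \<le> 2 powr ((log 2 (4 * real m))\<^sup>2 / 4) + 2 powr ((log 2 (real m))\<^sup>2 / 4)"
      using less.IH[of m] m quarter by (intro add_mono) auto
    also have "\<dots> \<le> 2 powr ((log 2 (4 * real k))\<^sup>2 / 4)"
      using powr_log_step[of "real m"] m by (simp add: add.commute)
    finally show ?thesis .
  qed
qed

theorem theorem1: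
  shows "(\<forall>k::nat. max_chromatic (k + 1) \<le> max_chromatic k + max_chromatic (k div 4)) \<and>
         (\<forall>k::nat. k \<ge> 1 \<longrightarrow> real (max_chromatic k) \<le> 2 powr ((log 2 (4 * real k))\<^sup>2 / 4))"
  using max_chromatic_Suc_le max_chromatic_le by simp

end
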